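(* Let $H:\mathbb{R}^n\to\mathbb{S}^p$ be a discrete-time exponential matrix control barrier function (DTE-MCBF) with constant $0<\gamma\le 1$ for the system $x_{k+1}=f(x_k)+g(x_k)u_k$. Write $H_k\triangleq H(x_k)$ and order the eigenvalues of $H_k$ as $\lambda_1(H_k)\le\lambda_2(H_k)\le\cdots\le\lambda_p(H_k)$. Suppose that $u_k\in K_H(x_k)$ for all $k\ge 0$. Then for all $k\geq 0$ $$\lambda_1(H_k)\;\ge\;(1-\gamma)^k\,\lambda_1(H_0).$$
   Context: $\mathbb{S}^p$ is the set of real symmetric $p\times p$ matrices; $A\succeq B$ means $A-B$ is positive semidefinite. The system is $x_{k+1}=f(x_k)+g(x_k)u_k$, $k\ge 0$, with $x_k\in\mathbb{R}^n$, $u_k\in\mathbb{R}^m$, and $f:\mathbb{R}^n\to\mathbb{R}^n$, $g:\mathbb{R}^n\to\mathbb{R}^{n\times m}$ locally Lipschitz. Let $S=\{x\in\mathbb{R}^n: H(x)\succeq 0\}$. A function $H:\mathbb{R}^n\to\mathbb{S}^p$ is a DTE-MCBF (with constant $\gamma$) if $0<\gamma\le1$ and there is a domain $\mathcal{D}\supset S$ such that for all $x\in\mathcal{D}$ there exists $u\in\mathbb{R}^m$ with $H(f(x)+g(x)u)\succeq(1-\gamma)H(x)$. The set of safety-preserving inputs is $K_H(x)=\{u\in\mathbb{R}^m: H(f(x)+g(x)u)\succeq(1-\gamma)H(x)\}$. *)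

theory Defs
  imports "HOL-Analysis.Analysis"
begin

definition symmetric_mat :: "real ^ 'p ^ 'p \<Rightarrow> bool" where
  "symmetric_mat A \<longleftrightarrow> transpose A = A"

definition psd :: "real ^ 'p ^ 'p \<Rightarrow> bool" where
  "psd A \<longleftrightarrow> symmetric_mat A \<and> (\<forall>v. 0 \<le> v \<bullet> (A *v v))"

definition loewner_ge :: "real ^ 'p ^ 'p \<Rightarrow> real ^ 'p ^ 'p \<Rightarrow> bool" (infix "\<succeq>" 50) where
  "A \<succeq> B \<longleftrightarrow> psd (A - B)"

definition eigenspace :: "real ^ 'p ^ 'p \<Rightarrow> real \<Rightarrow> (real ^ 'p) set" where
  "eigenspace A c = {v. A *v v = c *\<^sub>R v}"

definition eigenvalues :: "real ^ 'p ^ 'p \<Rightarrow> real set" where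
  "eigenvalues A = {c. \<exists>v. v \<noteq> 0 \<and> v \<in> eigenspace A c}"

(* The real eigenvalues in increasing order, each repeated according to the dimension of its
   eigenspace; for a symmetric matrix this is the usual list of CARD('p) eigenvalues. *)
definition eigenvalue_list :: "real ^ 'p ^ 'p \<Rightarrow> real list" where
  "eigenvalue_list A =
     concat (map (\<lambda>c. replicate (dim (eigenspace A c)) c) (sorted_list_of_set (eigenvalues A)))"

(* Indexed from 1, as in lambda_1(A) \<le> ... \<le> lambda_p(A); only meaningful for
   symmetric A and 1 \<le> i \<le> CARD('p). *)
definition eigval :: "nat \<Rightarrow> real ^ 'p ^ 'p \<Rightarrow> real" where
  "eigval i A = eigenvalue_list A ! (i - 1)"

(* The library's notion concerns functions of time and state; here the time argument is a dummy. *)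
definition locally_lipschitz :: "('a::metric_space \<Rightarrow> 'b::metric_space) \<Rightarrow> bool" where
  "locally_lipschitz f \<longleftrightarrow> local_lipschitz (UNIV :: real set) UNIV (\<lambda>_. f)"

definition safe_set :: "(real ^ 'n \<Rightarrow> real ^ 'p ^ 'p) \<Rightarrow> (real ^ 'n) set" where
  "safe_set H = {x. H x \<succeq> 0}"

definition safe_inputs ::
  "(real ^ 'n \<Rightarrow> real ^ 'n) \<Rightarrow> (real ^ 'n \<Rightarrow> real ^ 'm ^ 'n) \<Rightarrow> real \<Rightarrow>
   (real ^ 'n \<Rightarrow> real ^ 'p ^ 'p) \<Rightarrow> real ^ 'n \<Rightarrow> (real ^ 'm) set" where
  "safe_inputs f g \<gamma> H x = {u. H (f x + g x *v u) \<succeq> (1 - \<gamma>) *\<^sub>R H x}"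

(* A domain is a nonempty connected open set; it may coincide with the safe set. *)
definition DTE_MCBF ::
  "(real ^ 'n \<Rightarrow> real ^ 'n) \<Rightarrow> (real ^ 'n \<Rightarrow> real ^ 'm ^ 'n) \<Rightarrow> real \<Rightarrow>
   (real ^ 'n \<Rightarrow> real ^ 'p ^ 'p) \<Rightarrow> bool" where
  "DTE_MCBF f g \<gamma> H \<longleftrightarrow>
     (\<forall>x. symmetric_mat (H x)) \<and> 0 < \<gamma> \<and> \<gamma> \<le> 1 \<and>
     (\<exists>D. open D \<and> connected D \<and> D \<noteq> {} \<and> safe_set H \<subseteq> D \<and>
          (\<forall>x\<in>D. \<exists>u. H (f x + g x *v u) \<succeq> (1 - \<gamma>) *\<^sub>R H x))"

end

(* The smallest eigenvalue of a symmetric matrix is the minimum of its Rayleigh quotient. Evaluating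
   H(x_{k+1}) - (1 - gamma) H(x_k) \<succeq> 0 at a unit minimiser for H(x_{k+1}) gives
   lambda_1(H_{k+1}) \<ge> (1 - gamma) lambda_1(H_k), and the claim follows by induction. *)
theory Submission
  imports Defs
begin

lemma symmetric_mat_inner:
  assumes "symmetric_mat A"
  shows "v \<bullet> (A *v w) = (A *v v) \<bullet> w"
  using assms unfolding symmetric_mat_def
  by (metis dot_lmul_matrix transpose_matrix_vector)

text \<open>If \<open>B *v v\<close> were nonzero, a small move from \<open>v\<close> against it
  would make the form negative: the first-order term is strictly negative and outweighs the
  second-order one.\<close>

lemma psd_quadratic_form_eq_0:
  assumes B: "psd B" and v: "v \<bullet> (B *v v) = 0"
  shows "B *v v = 0"
proof (rule ccontr)
  define w where "w = B *v v"
  define a where "a = w \<bullet> w"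
  define b where "b = w \<bullet> (B *v w)"
  \<comment> \<open>Any positive \<open>s\<close> with \<open>s * b < 2 * a\<close> would do; the
    \<open>+ 1\<close> keeps the quotient meaningful when \<open>b = 0\<close>.\<close>
  define s where "s = a / (b + 1)"
  assume "B *v v \<noteq> 0"
  then have a: "a > 0" by (simp add: a_def w_def)
  have b: "b \<ge> 0" using B by (simp add: psd_def b_def)
  have s: "s > 0" using a b by (simp add: s_def)
  \<comment> \<open>By symmetry both cross terms of the expanded form equal
    \<open>a\<close>.\<close>
  have "v \<bullet> (B *v w) = a"
    using B by (simp add: psd_def symmetric_mat_inner a_def w_def)
  then have "(v - s *\<^sub>R w) \<bullet> (B *v (v - s *\<^sub>R w)) = s * (s * b - 2 * a)"
    using v
    by (simp add: matrix_vector_mult_diff_distrib matrix_vector_mult_scaleR inner_diff_left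
        inner_diff_right a_def b_def w_def[symmetric] algebra_simps)
  moreover have "0 \<le> (v - s *\<^sub>R w) \<bullet> (B *v (v - s *\<^sub>R w))"
    using B by (simp add: psd_def)
  ultimately have "2 * a \<le> s * b"
    using s by (simp add: zero_le_mult_iff)
  also have "s * b \<le> s * (b + 1)"
    using s by simp
  also have "\<dots> = a"
    using b by (simp add: s_def)
  finally show False using a by simp
qed

text \<open>By compactness the quadratic form attains a minimum \<open>c\<close> on the unit sphere,
  at some \<open>v\<close>. Then \<open>A - c I\<close> is positive semidefinite and its form
  vanishes at \<open>v\<close>, so \<open>v\<close> lies in its kernel. This replaces Lagrange
  multipliers and the spectral theorem.\<close>

lemma symmetric_mat_minimal_eigenvector:
  fixes A :: "real ^ 'p ^ 'p"
  assumes A: "symmetric_mat A"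
  obtains c v where "norm v = 1" "A *v v = c *\<^sub>R v" "\<And>w. c * (w \<bullet> w) \<le> w \<bullet> (A *v w)"
proof -
  have "continuous_on (sphere 0 1) (\<lambda>v. v \<bullet> (A *v v))"
    by (intro continuous_intros matrix_vector_mult_linear_continuous_on)
  moreover obtain b :: "real ^ 'p" where "b \<in> Basis"
    using nonempty_Basis by blast
  then have "sphere (0 :: real ^ 'p) 1 \<noteq> {}"
    by (auto intro!: exI[of _ b])
  ultimately obtain v where v: "norm v = 1"
    and min: "\<And>w. norm w = 1 \<Longrightarrow> v \<bullet> (A *v v) \<le> w \<bullet> (A *v w)"
    using continuous_attains_inf[of "sphere (0 :: real ^ 'p) 1" "\<lambda>v. v \<bullet> (A *v v)"]
    by (auto simp: compact_sphere)
  define c where "c = v \<bullet> (A *v v)"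
  have c: "c * (w \<bullet> w) \<le> w \<bullet> (A *v w)" for w
  proof (cases "w = 0")
    case False
    then have "c \<le> (inverse (norm w) *\<^sub>R w) \<bullet> (A *v (inverse (norm w) *\<^sub>R w))"
      unfolding c_def by (intro min) simp
    also have "\<dots> = (w \<bullet> (A *v w)) / (w \<bullet> w)"
      by (simp add: matrix_vector_mult_scaleR dot_square_norm power2_eq_square field_simps)
    finally show ?thesis using False by (simp add: field_simps)
  qed simp
  define B where "B = A - c *\<^sub>R mat 1"
  have B: "B *v w = A *v w - c *\<^sub>R w" for w
    by (simp add: B_def matrix_vector_mult_diff_rdistrib scaleR_matrix_vector_assoc[symmetric])
  have "symmetric_mat B"
    using A by (auto simp: symmetric_mat_def B_def transpose_def vec_eq_iff mat_def)
  then have "psd B"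
    using c by (simp add: psd_def B inner_diff_right)
  moreover have "v \<bullet> (B *v v) = 0"
    using v by (simp add: B inner_diff_right c_def dot_square_norm)
  ultimately have "A *v v = c *\<^sub>R v"
    using psd_quadratic_form_eq_0 B by fastforce
  then show ?thesis using that v c by blast
qed

lemma symmetric_mat_eigenvectors_orthogonal:
  assumes "symmetric_mat A" "v \<in> eigenspace A c" "w \<in> eigenspace A d" "c \<noteq> d"
  shows "v \<bullet> w = 0"
  using symmetric_mat_inner[OF assms(1), of v w] assms(2-4) by (simp add: eigenspace_def)

text \<open>Eigenvectors chosen for distinct eigenvalues are nonzero and pairwise orthogonal, hence
  independent. Finiteness matters because \<open>sorted_list_of_set\<close> returns the empty list
  on an infinite set.\<close>

lemma finite_eigenvalues:
  fixes A :: "real ^ 'p ^ 'p"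
  assumes A: "symmetric_mat A"
  shows "finite (eigenvalues A)"
proof -
  have "\<forall>c\<in>eigenvalues A. \<exists>v. v \<noteq> 0 \<and> v \<in> eigenspace A c"
    by (simp add: eigenvalues_def)
  then obtain e where e: "\<And>c. c \<in> eigenvalues A \<Longrightarrow> e c \<noteq> 0 \<and> e c \<in> eigenspace A c"
    using bchoice by metis
  have orth: "e c \<bullet> e d = 0" if "c \<in> eigenvalues A" "d \<in> eigenvalues A" "c \<noteq> d" for c d
    using symmetric_mat_eigenvectors_orthogonal[OF A] e that by blast
  \<comment> \<open>A vector shared by two eigenvalues would be orthogonal to itself, hence zero.
    Injectivity carries finiteness of the image back to the eigenvalues.\<close>
  have "inj_on e (eigenvalues A)"
    using e orth by (metis inj_onI inner_eq_zero_iff)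
  moreover have "independent (e ` eigenvalues A)"
    using e orth
    by (intro pairwise_orthogonal_independent) (auto simp: pairwise_def orthogonal_def)
  ultimately show ?thesis
    using independent_imp_finite finite_image_iff by blast
qed

lemma eigval_1_eq_Min:
  fixes A :: "real ^ 'p ^ 'p"
  assumes fin: "finite (eigenvalues A)" and ne: "eigenvalues A \<noteq> {}"
  shows "eigval 1 A = Min (eigenvalues A)"
proof -
  let ?m = "Min (eigenvalues A)"
  have "?m \<in> eigenvalues A"
    using assms by simp
  then obtain v where "v \<noteq> 0" "v \<in> eigenspace A ?m"
    by (auto simp: eigenvalues_def)
  \<comment> \<open>The first block of the list must be nonempty; otherwise position 0 would not
    hold \<open>?m\<close>.\<close>
  then have "dim (eigenspace A ?m) \<noteq> 0"
    by (auto simp: dim_eq_0)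
  then obtain n where "dim (eigenspace A ?m) = Suc n"
    using not0_implies_Suc by blast
  then show ?thesis
    using sorted_list_of_set_nonempty[OF fin ne] by (simp add: eigval_def eigenvalue_list_def)
qed

text \<open>The minimum \<open>c\<close> of the form on the unit sphere is itself an eigenvalue, and
  evaluating the form at any other eigenvector shows that no eigenvalue lies below
  \<open>c\<close>.\<close>

lemma eigval_1_Rayleigh:
  fixes A :: "real ^ 'p ^ 'p"
  assumes A: "symmetric_mat A"
  shows eigval_1_le_quadratic_form: "eigval 1 A * (w \<bullet> w) \<le> w \<bullet> (A *v w)"
    and eigval_1_attained: "\<exists>v. v \<bullet> v = 1 \<and> v \<bullet> (A *v v) = eigval 1 A"
proof -
  obtain c v where v: "norm v = 1" "A *v v = c *\<^sub>R v"
    and c: "\<And>w. c * (w \<bullet> w) \<le> w \<bullet> (A *v w)"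
    using symmetric_mat_minimal_eigenvector[OF A] by blast
  have mem: "c \<in> eigenvalues A"
    using v by (auto simp: eigenvalues_def eigenspace_def intro!: exI[of _ v])
  have "c \<le> d" if d: "d \<in> eigenvalues A" for d
  proof -
    obtain w where "w \<noteq> 0" "A *v w = d *\<^sub>R w"
      using d by (auto simp: eigenvalues_def eigenspace_def)
    then show ?thesis using c[of w] by simp
  qed
  with mem have "Min (eigenvalues A) = c"
    using finite_eigenvalues[OF A] by (intro Min_eqI)
  then have "eigval 1 A = c"
    using eigval_1_eq_Min finite_eigenvalues[OF A] mem by blast
  then show "eigval 1 A * (w \<bullet> w) \<le> w \<bullet> (A *v w)"
    and "\<exists>v. v \<bullet> v = 1 \<and> v \<bullet> (A *v v) = eigval 1 A"
    using v c by (auto simp: dot_square_norm intro!: exI[of _ v])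
qed

lemma eigval_1_loewner_scaled:
  fixes A B :: "real ^ 'p ^ 'p"
  assumes A: "symmetric_mat A" and B: "symmetric_mat B"
    and "c \<ge> 0" and ge: "A \<succeq> c *\<^sub>R B"
  shows "eigval 1 A \<ge> c * eigval 1 B"
proof -
  obtain v where v: "v \<bullet> v = 1" "v \<bullet> (A *v v) = eigval 1 A"
    using eigval_1_attained[OF A] by blast
  \<comment> \<open>The vector \<open>v\<close> is a minimiser for \<open>A\<close>; for
    \<open>B\<close> it only gives an upper bound on the smallest eigenvalue, which is the direction
    required here.\<close>
  have "c * eigval 1 B \<le> c * (v \<bullet> (B *v v))"
    using eigval_1_le_quadratic_form[OF B, of v] v(1) \<open>c \<ge> 0\<close> by (simp add: mult_left_mono)
  also have "\<dots> \<le> v \<bullet> (A *v v)"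
  proof -
    have "0 \<le> v \<bullet> ((A - c *\<^sub>R B) *v v)"
      using ge by (simp add: loewner_ge_def psd_def)
    then show ?thesis
      by (simp add: matrix_vector_mult_diff_rdistrib scaleR_matrix_vector_assoc[symmetric]
          inner_diff_right)
  qed
  finally show ?thesis using v(2) by simp
qed

theorem theorem4:
  fixes f :: "real ^ 'n \<Rightarrow> real ^ 'n"
    and g :: "real ^ 'n \<Rightarrow> real ^ 'm ^ 'n"
    and H :: "real ^ 'n \<Rightarrow> real ^ 'p ^ 'p"
    and \<gamma> :: real
    and x :: "nat \<Rightarrow> real ^ 'n"
    and u :: "nat \<Rightarrow> real ^ 'm"
  assumes "locally_lipschitz f"
    and "locally_lipschitz g"
    and "DTE_MCBF f g \<gamma> H"
    and "\<And>k. x (Suc k) = f (x k) + g (x k) *v u k"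
    and "\<And>k. u k \<in> safe_inputs f g \<gamma> H (x k)"
  shows "\<forall>k. eigval 1 (H (x k)) \<ge> (1 - \<gamma>) ^ k * eigval 1 (H (x 0))"
proof
  fix k
  have sym: "symmetric_mat (H y)" for y
    using assms(3) by (simp add: DTE_MCBF_def)
  have \<gamma>: "0 \<le> 1 - \<gamma>"
    using assms(3) by (simp add: DTE_MCBF_def)
  show "eigval 1 (H (x k)) \<ge> (1 - \<gamma>) ^ k * eigval 1 (H (x 0))"
  proof (induction k)
    case (Suc k)
    have "H (x (Suc k)) \<succeq> (1 - \<gamma>) *\<^sub>R H (x k)"
      using assms(5)[of k] by (simp add: safe_inputs_def assms(4))
    then have "(1 - \<gamma>) * eigval 1 (H (x k)) \<le> eigval 1 (H (x (Suc k)))"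
      using eigval_1_loewner_scaled sym \<gamma> by blast
    \<comment> \<open>Only the sign of \<open>1 - \<gamma>\<close> enters, so the eigenvalues may be
      negative and the initial state unsafe.\<close>
    moreover have "(1 - \<gamma>) ^ Suc k * eigval 1 (H (x 0)) \<le> (1 - \<gamma>) * eigval 1 (H (x k))"
      using mult_left_mono[OF Suc.IH \<gamma>] by (simp add: mult.assoc)
    ultimately show ?case by linarith
  qed simp
qed

end
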